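(* Let $D\subset\mathbb{C}^m$ be a strictly hyperconvex domain, and let $\Omega$ and $\rho$ be a bounded domain and a function as in the definition of strict hyperconvexity of $D$. Assume that for each $k\in\mathbb{N}$ the set $D^k:=\{z\in\Omega:\rho(z)<\frac{1}{k}\}$ is a hyperconvex domain. Let $(D_n)_{n\in\mathbb{N}}$ be a sequence of bounded domains in $\mathbb{C}^m$ such that $$\lim_{n\rightarrow\infty}\mathfrak{H}(\overline{D}_n,\overline{D})=0.$$ Assume that for each compact $K\subset D$ there exists an $n_0\in\mathbb{N}$ such that $K\subset D_n$ for every $n\geq n_0$. Then for any $z,w\in D$ $$\lim_{n\rightarrow\infty}\boldsymbol{g}_{D_n}(z,w)=\boldsymbol{g}_D(z,w).$$
   Context: A domain is a nonempty connected open subset of some $\mathbb{C}^n$; $\mathbb{N}=\{1,2,\dots\}$. $\mathcal{PSH}(D)$ denotes the family of plurisubharmonic functions on the open set $D$ (the function $\equiv-\infty$ being allowed, and $\log 0=-\infty$). $\mathbb{B}(x,r)$ is the open Euclidean ball of center $x$ and radius $r$. Let $D\subset\mathbb{C}^m$ be a bounded domain. $D$ is hyperconvex if there exists a continuous and negative plurisubharmonic exhaustive function on $D$ (that is, a continuous $u\in\mathcal{PSH}(D)$, $u<0$, with $\{z\in D:u(z)<\alpha\}$ relatively compact in $D$ for every $\alpha<0$). $D$ is strictly hyperconvex if there exist a bounded domain $\Omega\subset\mathbb{C}^m$ and a continuous function $\rho\in\mathcal{PSH}(\Omega)$ with values in $(-\infty,1)$ such that $D=\{z\in\Omega:\rho(z)<0\}$,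 $\rho$ is exhaustive for $\Omega$ (that is, $\{z\in\Omega:\rho(z)<\alpha\}$ is relatively compact in $\Omega$ for every $\alpha<1$), and the sublevel sets $\{z\in\Omega:\rho(z)<\alpha\}$ are connected for all $\alpha\in[0,1]$. Green function of a domain $D$: for $z,w\in D$, $$\boldsymbol{g}_D(z,w):=\sup\{u(z)\},$$ the supremum being over all $u:D\rightarrow[0,1)$ such that $\log u\in\mathcal{PSH}(D)$ and there exist $M,r>0$ (depending on $u$) with $\mathbb{B}(w,r)\subset D$ and $u(\zeta)\leq M\|\zeta-w\|$ for $\zeta\in\mathbb{B}(w,r)$. Hausdorff distance: for nonempty bounded sets $A,B\subset\mathbb{C}^m$, $\mathfrak{H}(A,B):=\inf\{\delta>0: A\subset B^{(\delta)}\text{ and }B\subset A^{(\delta)}\}$, where $S^{(\varepsilon)}:=\bigcup_{s\in S}\mathbb{B}(s,\varepsilon)$. The limit is taken over those $n$ large enough that $z,w\in D_n$ (which by the hypotheses holds for all sufficiently large $n$). *)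

theory Defs
  imports "HOL-Analysis.Analysis"
begin

definition domain :: "'a::topological_space set \<Rightarrow> bool" where
  "domain D \<longleftrightarrow> open D \<and> connected D \<and> D \<noteq> {}"

definition bounded_domain :: "'a::metric_space set \<Rightarrow> bool" where
  "bounded_domain D \<longleftrightarrow> domain D \<and> bounded D"

definition relatively_compact_in :: "'a::topological_space set \<Rightarrow> 'a set \<Rightarrow> bool" where
  "relatively_compact_in S D \<longleftrightarrow> compact (closure S) \<and> closure S \<subseteq> D"


subsection \<open>Plurisubharmonic functions\<close>

text \<open>
  (Pluri)subharmonic functions take values in \<open>[-\<infinity>, \<infinity>)\<close>, so they are modelled as
  \<^typ>\<open>ereal\<close>-valued functions; only their values on the set in question matter.
\<close>

definition usc_on :: "'a::topological_space set \<Rightarrow> ('a \<Rightarrow> ereal) \<Rightarrow> bool" where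
  "usc_on D u \<longleftrightarrow> (\<forall>z\<in>D. u z < \<infinity>) \<and> (\<forall>c. openin (top_of_set D) {z \<in> D. u z < c})"

text \<open>
  The integral mean over the circle of centre \<open>a\<close> and radius \<open>r\<close> is the integral of the positive
  part minus that of the negative part (\<^const>\<open>e2ennreal\<close> truncates negative values to \<open>0\<close>). For
  \<open>u\<close> upper semicontinuous and less than \<open>\<infinity>\<close> on the circle the first integral is finite, so the
  difference is well defined; it may be \<open>-\<infinity>\<close>.
\<close>

definition circle_mean :: "(complex \<Rightarrow> ereal) \<Rightarrow> complex \<Rightarrow> real \<Rightarrow> ereal" where
  "circle_mean u a r =
     (enn2ereal (\<integral>\<^sup>+t\<in>{0..2*pi}. e2ennreal (u (a + of_real r * cis t)) \<partial>lborel)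
      - enn2ereal (\<integral>\<^sup>+t\<in>{0..2*pi}. e2ennreal (- u (a + of_real r * cis t)) \<partial>lborel))
     / ereal (2 * pi)"

text \<open>
  Subharmonicity on an open subset of the plane: upper semicontinuity and the local submean
  inequality (the definition in Ransford, Potential Theory in the Complex Plane). The function
  that is identically \<open>-\<infinity>\<close> is allowed.
\<close>

definition subharmonic_on :: "complex set \<Rightarrow> (complex \<Rightarrow> ereal) \<Rightarrow> bool" where
  "subharmonic_on U u \<longleftrightarrow> usc_on U u \<and>
     (\<forall>a\<in>U. \<exists>R>0. ball a R \<subseteq> U \<and> (\<forall>r. 0 < r \<and> r < R \<longrightarrow> u a \<le> circle_mean u a r))"

definition plurisubharmonic_on :: "(complex ^ 'm) set \<Rightarrow> (complex ^ 'm \<Rightarrow> ereal) \<Rightarrow> bool" where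
  "plurisubharmonic_on D u \<longleftrightarrow> usc_on D u \<and>
     (\<forall>a\<in>D. \<forall>b. subharmonic_on {s. a + s *s b \<in> D} (\<lambda>s. u (a + s *s b)))"


subsection \<open>Hyperconvexity\<close>

text \<open>
  Continuity of the exhaustion function is continuity as a map into the extended reals: the value
  \<open>-\<infinity>\<close> is not excluded.
\<close>

definition hyperconvex :: "(complex ^ 'm) set \<Rightarrow> bool" where
  "hyperconvex D \<longleftrightarrow> bounded_domain D \<and>
     (\<exists>u :: complex ^ 'm \<Rightarrow> ereal. continuous_on D u \<and> plurisubharmonic_on D u \<and>
        (\<forall>z\<in>D. u z < 0) \<and>
        (\<forall>\<alpha>::real. \<alpha> < 0 \<longrightarrow> relatively_compact_in {z \<in> D. u z < ereal \<alpha>} D))"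

definition strict_hyperconvexity_data ::
  "(complex ^ 'm) set \<Rightarrow> (complex ^ 'm) set \<Rightarrow> (complex ^ 'm \<Rightarrow> real) \<Rightarrow> bool" where
  "strict_hyperconvexity_data D \<Omega> \<rho> \<longleftrightarrow>
     bounded_domain \<Omega> \<and>
     continuous_on \<Omega> \<rho> \<and> plurisubharmonic_on \<Omega> (\<lambda>z. ereal (\<rho> z)) \<and> (\<forall>z\<in>\<Omega>. \<rho> z < 1) \<and>
     D = {z \<in> \<Omega>. \<rho> z < 0} \<and>
     (\<forall>\<alpha><1. relatively_compact_in {z \<in> \<Omega>. \<rho> z < \<alpha>} \<Omega>) \<and>
     (\<forall>\<alpha>\<in>{0..1}. connected {z \<in> \<Omega>. \<rho> z < \<alpha>})"

definition strictly_hyperconvex :: "(complex ^ 'm) set \<Rightarrow> bool" where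
  "strictly_hyperconvex D \<longleftrightarrow>
     bounded_domain D \<and> (\<exists>\<Omega> \<rho>. strict_hyperconvexity_data D \<Omega> \<rho>)"


subsection \<open>Green function\<close>

definition log_ereal :: "real \<Rightarrow> ereal" where
  "log_ereal x = (if x = 0 then -\<infinity> else ereal (ln x))"

definition green_candidates ::
  "(complex ^ 'm) set \<Rightarrow> complex ^ 'm \<Rightarrow> (complex ^ 'm \<Rightarrow> real) set" where
  "green_candidates D w =
     {u. (\<forall>z\<in>D. 0 \<le> u z \<and> u z < 1) \<and> plurisubharmonic_on D (\<lambda>z. log_ereal (u z)) \<and>
         (\<exists>M>0. \<exists>r>0. ball w r \<subseteq> D \<and> (\<forall>\<zeta>\<in>ball w r. u \<zeta> \<le> M * norm (\<zeta> - w)))}"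

text \<open>Meaningful for \<open>z, w \<in> D\<close>; then the supremum is over a nonempty subset of \<open>[0, 1)\<close>.\<close>

definition green :: "(complex ^ 'm) set \<Rightarrow> complex ^ 'm \<Rightarrow> complex ^ 'm \<Rightarrow> real" where
  "green D z w = (SUP u\<in>green_candidates D w. u z)"


subsection \<open>Hausdorff distance\<close>

definition thickening :: "'a::metric_space set \<Rightarrow> real \<Rightarrow> 'a set" where
  "thickening S \<epsilon> = (\<Union>s\<in>S. ball s \<epsilon>)"

definition hausdorff_distance :: "'a::metric_space set \<Rightarrow> 'a set \<Rightarrow> real" where
  "hausdorff_distance A B = Inf {\<delta>. \<delta> > 0 \<and> A \<subseteq> thickening B \<delta> \<and> B \<subseteq> thickening A \<delta>}"

end

theory Submission
  imports Defs "HOL-Complex_Analysis.Cauchy_Integral_Formula"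
begin

text \<open>
  Write \<open>S t = {x \<in> \<Omega>. \<rho> x < t}\<close>, so that \<open>D = S 0\<close>. The set \<open>{\<rho> \<le> -s}\<close> is a compact part of \<open>D\<close>, and
  \<open>closure D\<close> is a compact part of the open set \<open>S s\<close>. The two modes of convergence in the
  hypotheses therefore give \<open>S (-s) \<subseteq> Dn n \<subseteq> S s\<close> for each small \<open>s > 0\<close> and all large \<open>n\<close>. Since
  the Green function decreases when the domain grows (\<open>green_antimono\<close>), it is enough to compare
  the Green functions of nearby sublevel sets of \<open>\<rho>\<close>.

  This is \<open>green_sublevel_le\<close>: there is a constant \<open>A\<close>, depending on \<open>w\<close> only, such that
  \<open>green (S a) z w \<le> exp (2 * A * (b - a)) * green (S b) z w\<close> when \<open>a < b\<close> are close to \<open>0\<close> and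
  \<open>b \<ge> 0\<close>. To see it, let \<open>u\<close> compete for \<open>S a\<close>. Suppose that \<open>H\<close> competes for \<open>S b\<close> and is at least
  \<open>exp (A * (\<rho> - b))\<close> away from \<open>w\<close>. Near the boundary of \<open>S a\<close> one has \<open>\<rho> - b > - 2 * (b - a)\<close>,
  and so \<open>H\<close> exceeds \<open>\<kappa> = exp (- 2 * A * (b - a))\<close>, hence also \<open>\<kappa> * u\<close>. So the function that is
  \<open>max (\<kappa> * u) H\<close> on \<open>S a\<close> and \<open>H\<close> elsewhere has a plurisubharmonic logarithm and competes for
  \<open>S b\<close>, and its value at \<open>z\<close> is at least \<open>\<kappa> * u z\<close>. The function \<open>H\<close> is obtained by the same
  gluing: it is \<open>norm (x - w) / R\<close> near \<open>w\<close>, with \<open>R\<close> so large that this is less than \<open>1\<close> on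
  \<open>\<Omega>\<close>, and the maximum of this with \<open>exp (A * (\<rho> - b))\<close> elsewhere. A large \<open>A\<close> makes the
  exponential the smaller one of the two where the pieces meet, because \<open>\<rho>\<close> is negative and
  bounded away from \<open>0\<close> near \<open>w\<close>.

  The rest is elementary pluripotential theory: the properties of circle means, the locality of
  plurisubharmonicity with the gluing lemma \<open>plurisubharmonic_on_max_glue\<close>, and the
  plurisubharmonicity of \<open>log (norm (x - w))\<close>, which comes from Cauchy's integral formula for a
  branch of the logarithm.
\<close>


section \<open>Circle means\<close>

lemma continuous_on_line: "continuous_on S (\<lambda>s. a + s *s b :: complex ^ 'm)"
  unfolding vector_scalar_mult_def
  by (intro continuous_intros continuous_on_vec_lambda)

lemma circle_mean_mono:
  assumes "\<And>t. u (a + of_real r * cis t) \<le> v (a + of_real r * cis t)"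
  shows "circle_mean u a r \<le> circle_mean v a r"
  unfolding circle_mean_def
  by (intro ereal_divide_right_mono ereal_minus_mono)
     (auto intro!: nn_integral_mono mult_right_mono e2ennreal_mono simp: assms less_eq_ennreal.rep_eq[symmetric])

lemma circle_mean_cong:
  assumes "\<And>t. u (a + of_real r * cis t) = v (a + of_real r * cis t)"
  shows "circle_mean u a r = circle_mean v a r"
  using assms by (simp add: circle_mean_def)

text \<open>
  For a continuous real function both integrals in the mean are finite, so the extended-valued
  expression collapses to an ordinary integral, with its linearity.
\<close>

lemma circle_mean_real:
  assumes "continuous_on (sphere a r) f" and "r \<ge> 0"
  shows "circle_mean (\<lambda>s. ereal (f s)) a r
           = ereal (integral {0..2*pi} (\<lambda>t. f (a + of_real r * cis t)) / (2*pi))"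
proof -
  define g where "g t = f (a + of_real r * cis t)" for t
  have cg: "continuous_on {0..2*pi} g"
    unfolding g_def
    by (rule continuous_on_compose2[OF assms(1)])
       (use assms(2) in \<open>auto intro!: continuous_intros simp: dist_norm norm_mult\<close>)
  have int: "set_integrable lborel {0..2*pi} g"
    by (rule borel_integrable_atLeastAtMost') (rule cg)
  then have int': "integrable lborel (\<lambda>t. indicator {0..2*pi} t * g t)"
    by (simp add: set_integrable_def)
  let ?P = "\<integral>\<^sup>+t\<in>{0..2*pi}. ennreal (g t) \<partial>lborel"
  let ?N = "\<integral>\<^sup>+t\<in>{0..2*pi}. ennreal (- g t) \<partial>lborel"
  have P: "?P = (\<integral>\<^sup>+t. ennreal (indicator {0..2*pi} t * g t) \<partial>lborel)"
    and N: "?N = (\<integral>\<^sup>+t. ennreal (- (indicator {0..2*pi} t * g t)) \<partial>lborel)"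
    by (auto intro!: nn_integral_cong simp: indicator_def)
  have fin: "?P < \<infinity>" "?N < \<infinity>"
    unfolding P N using int' by (auto simp: real_integrable_def less_top)
  have "integral {0..2*pi} g = enn2real ?P - enn2real ?N"
    using set_borel_integral_eq_integral(2)[OF int] real_lebesgue_integral_def[OF int']
    by (simp add: P N set_lebesgue_integral_def)
  moreover have "enn2ereal ?P = ereal (enn2real ?P)" "enn2ereal ?N = ereal (enn2real ?N)"
    using fin by (cases ?P; cases ?N; force)+
  ultimately show ?thesis
    unfolding circle_mean_def g_def[symmetric] by simp
qed

text \<open>
  The disc \<open>p + s * \<beta>\<close>, \<open>cmod s \<le> r\<close>, lies in the right half plane, so the integrand is the real
  part of a holomorphic branch of the logarithm there, and Cauchy's formula at the centre gives
  the mean value.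
\<close>

lemma log_mean_value:
  fixes p r :: real and \<beta> :: complex
  assumes "p > 0" "r > 0" "r * cmod \<beta> < p"
  shows "integral {0..2*pi} (\<lambda>t. ln (cmod (of_real p + of_real r * cis t * \<beta>))) = 2*pi * ln p"
proof -
  have re: "Re (of_real p + s * \<beta>) > 0" if "cmod s \<le> r" for s
  proof -
    have "cmod (s * \<beta>) < p"
      using that assms by (smt (verit) norm_mult mult_right_mono norm_ge_zero)
    then show ?thesis
      using abs_Re_le_cmod[of "s * \<beta>"] by simp
  qed
  have nonpos: "of_real p + s * \<beta> \<notin> \<real>\<^sub>\<le>\<^sub>0" if "cmod s \<le> r" for s
    using re[OF that] by (auto simp: complex_nonpos_Reals_iff)
  have "(\<lambda>s. Ln (of_real p + s * \<beta>)) holomorphic_on cball 0 r"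
    using nonpos by (auto intro!: holomorphic_intros)
  from Cauchy_integral_circlepath_simple[OF this, of 0] assms
  have "((\<lambda>s. Ln (of_real p + s * \<beta>) / s) has_contour_integral (2 * of_real pi * \<i> * Ln (of_real p)))
          (part_circlepath 0 r 0 (2*pi))"
    by (simp add: circlepath_def)
  then have "((\<lambda>t. Ln (of_real p + r * cis t * \<beta>) * \<i>) has_integral (2 * of_real pi * \<i> * Ln (of_real p))) {0..2*pi}"
    using assms by (subst (asm) has_contour_integral_part_circlepath_iff) (auto simp: field_simps)
  from has_integral_Im[OF this]
  have "((\<lambda>t. Re (Ln (of_real p + r * cis t * \<beta>))) has_integral (2 * pi * ln p)) {0..2*pi}"
    using assms by (simp add: Ln_of_real)
  moreover have "Re (Ln (of_real p + r * cis t * \<beta>)) = ln (cmod (of_real p + r * cis t * \<beta>))" for t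
    using nonpos[of "r * cis t"] assms by (subst Re_Ln) (auto simp: norm_mult)
  ultimately show ?thesis
    by (simp add: integral_unique)
qed

text \<open>
  For functions that may be \<open>-\<infinity>\<close> on a large set one cannot pass to real integrals. If the function
  is nonpositive, however, only the integral of the negative part survives, and subtracting \<open>c \<ge> 0\<close>
  adds \<open>2 * pi * c\<close> to it, even when it is infinite.
\<close>

lemma circle_mean_nonpos_diff:
  assumes mble: "(\<lambda>t. u (a + of_real r * cis t)) \<in> borel_measurable borel"
    and le0: "\<And>t. u (a + of_real r * cis t) \<le> 0" and c: "c \<ge> 0"
  shows "circle_mean (\<lambda>s. u s - ereal c) a r = circle_mean u a r - ereal c"
proof -
  define f where "f t = u (a + of_real r * cis t)" for t
  have [measurable]: "f \<in> borel_measurable borel"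
    using mble by (simp add: f_def[abs_def])
  have f0: "f t \<le> 0" for t
    using le0 by (simp add: f_def)
  let ?N = "\<integral>\<^sup>+t\<in>{0..2*pi}. e2ennreal (- f t) \<partial>lborel"
  have split: "e2ennreal (- (f t - ereal c)) = e2ennreal (- f t) + ennreal c" for t
  proof -
    have "- (f t - ereal c) = - f t + ereal c"
      by (cases "f t") auto
    then show ?thesis
      using f0[of t] c by (cases "f t") (auto simp flip: ennreal_plus)
  qed
  have N': "(\<integral>\<^sup>+t\<in>{0..2*pi}. e2ennreal (- (f t - ereal c)) \<partial>lborel) = ?N + ennreal (2*pi*c)"
    using c by (simp add: split distrib_right nn_integral_add nn_integral_cmult_indicator ennreal_mult' mult.commute)
  have "e2ennreal (f t) = 0" "e2ennreal (f t - ereal c) = 0" for t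
    using f0[of t] c by (auto intro!: e2ennreal_neg simp: ereal_minus_le_iff) (cases "f t"; simp)+
  then show ?thesis
    using c unfolding circle_mean_def f_def[symmetric] N'
    by (cases "enn2ereal ?N") (auto simp: plus_ennreal.rep_eq zero_ennreal.rep_eq field_simps)
qed


section \<open>Plurisubharmonic functions\<close>

lemma usc_on_open_iff:
  assumes "open D"
  shows "usc_on D u \<longleftrightarrow> (\<forall>z\<in>D. u z < \<infinity>) \<and> (\<forall>c. open {z \<in> D. u z < c})"
proof -
  have "openin (top_of_set D) {z \<in> D. u z < c} \<longleftrightarrow> open {z \<in> D. u z < c}" for c
    using assms by (auto simp: openin_open_eq)
  then show ?thesis
    by (simp add: usc_on_def)
qed

lemma eventually_circle_in:
  fixes a b :: "complex ^ 'm"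
  assumes "open V" "a \<in> V"
  shows "\<forall>\<^sub>F r in at_right 0. \<forall>s. cmod s = r \<longrightarrow> a + s *s b \<in> V"
proof -
  have "open ((\<lambda>s. a + s *s b) -` V)"
    using continuous_on_line assms by (intro open_vimage) auto
  moreover have "0 \<in> (\<lambda>s. a + s *s b) -` V"
    using assms by simp
  ultimately obtain R where "R > 0" "ball 0 R \<subseteq> (\<lambda>s. a + s *s b) -` V"
    unfolding open_contains_ball by blast
  then have "\<forall>r>0. r < R \<longrightarrow> (\<forall>s. cmod s = r \<longrightarrow> a + s *s b \<in> V)"
    by (auto simp: subset_iff)
  with \<open>R > 0\<close> show ?thesis
    unfolding eventually_at_right_field by blast
qed

text \<open>
  A complex line through \<open>D\<close> can be reparametrized so that any of its points in \<open>D\<close> is the centre.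
  This replaces subharmonicity on a slice of \<open>D\<close> by submean inequalities at the parameter \<open>0\<close>.
  As these concern small radii only, they are visibly local.
\<close>

lemma plurisubharmonic_on_iff:
  assumes "open D"
  shows "plurisubharmonic_on D u \<longleftrightarrow> usc_on D u \<and>
    (\<forall>a\<in>D. \<forall>b. \<forall>\<^sub>F r in at_right 0. u a \<le> circle_mean (\<lambda>s. u (a + s *s b)) 0 r)"
    (is "?L \<longleftrightarrow> _ \<and> ?M")
proof (intro iffI conjI)
  assume L: ?L
  show "usc_on D u"
    using L by (simp add: plurisubharmonic_on_def)
  show ?M
  proof (intro ballI allI)
    fix a b assume "a \<in> D"
    then have "subharmonic_on {s. a + s *s b \<in> D} (\<lambda>s. u (a + s *s b))" "0 \<in> {s. a + s *s b \<in> D}"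
      using L by (auto simp: plurisubharmonic_on_def)
    then obtain R where "R > 0"
        "\<And>r. 0 < r \<Longrightarrow> r < R \<Longrightarrow> u (a + 0 *s b) \<le> circle_mean (\<lambda>s. u (a + s *s b)) 0 r"
      unfolding subharmonic_on_def by blast
    then show "\<forall>\<^sub>F r in at_right 0. u a \<le> circle_mean (\<lambda>s. u (a + s *s b)) 0 r"
      unfolding eventually_at_right_field by auto
  qed
next
  assume R: "usc_on D u \<and> ?M"
  have "subharmonic_on {s. a + s *s b \<in> D} (\<lambda>s. u (a + s *s b))" if "a \<in> D" for a b
    unfolding subharmonic_on_def
  proof (intro conjI ballI)
    let ?S = "{s. a + s *s b \<in> D}"
    have pre: "open {s. a + s *s b \<in> V}" if "open V" for V
      using open_vimage[OF that continuous_on_line[of UNIV a b]] by (simp add: vimage_def)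
    show "usc_on ?S (\<lambda>s. u (a + s *s b))"
    proof (subst usc_on_open_iff[OF pre[OF assms]], intro conjI allI ballI)
      fix s assume "s \<in> ?S" then show "u (a + s *s b) < \<infinity>"
        using R by (simp add: usc_on_def)
    next
      fix c
      have "open {z \<in> D. u z < c}"
        using R usc_on_open_iff[OF assms, of u] by blast
      from pre[OF this] show "open {s \<in> ?S. u (a + s *s b) < c}"
        by simp
    qed
    fix s0 assume s0: "s0 \<in> ?S"
    obtain R1 where R1: "R1 > 0" "ball s0 R1 \<subseteq> ?S"
      using pre[OF assms] s0 unfolding open_contains_ball by blast
    have shift: "circle_mean (\<lambda>s. u (a + s *s b)) s0 r
                   = circle_mean (\<lambda>s. u ((a + s0 *s b) + s *s b)) 0 r" for r
      by (simp add: circle_mean_def vector_sadd_rdistrib add.assoc)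
    have "\<forall>\<^sub>F r in at_right 0. u (a + s0 *s b) \<le> circle_mean (\<lambda>s. u (a + s *s b)) s0 r"
      unfolding shift using R s0 by blast
    then obtain R2 where R2: "R2 > 0"
        "\<And>r. 0 < r \<Longrightarrow> r < R2 \<Longrightarrow> u (a + s0 *s b) \<le> circle_mean (\<lambda>s. u (a + s *s b)) s0 r"
      unfolding eventually_at_right_field by blast
    show "\<exists>R>0. ball s0 R \<subseteq> ?S \<and>
      (\<forall>r. 0 < r \<and> r < R \<longrightarrow> u (a + s0 *s b) \<le> circle_mean (\<lambda>s. u (a + s *s b)) s0 r)"
      using R1 R2 by (intro exI[of _ "min R1 R2"]) (auto simp: subset_iff)
  qed
  with R show ?L
    by (simp add: plurisubharmonic_on_def)
qed

lemma plurisubharmonic_on_submean: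
  assumes "open D" "plurisubharmonic_on D u" "a \<in> D"
  shows "\<forall>\<^sub>F r in at_right 0. u a \<le> circle_mean (\<lambda>s. u (a + s *s b)) 0 r"
  using assms by (simp add: plurisubharmonic_on_iff)

lemma usc_on_circle_measurable:
  fixes a b :: "complex ^ 'm"
  assumes "open D" "usc_on D u" "\<And>t. a + (of_real r * cis t) *s b \<in> D"
  shows "(\<lambda>t. u (a + (of_real r * cis t) *s b)) \<in> borel_measurable borel"
proof (rule borel_measurableI_less)
  fix c
  have "continuous_on UNIV ((\<lambda>s. a + s *s b) \<circ> (\<lambda>t. of_real r * cis t))"
    by (intro continuous_on_compose continuous_on_line continuous_intros)
  moreover have "open {z \<in> D. u z < c}"
    using assms usc_on_open_iff by blast
  ultimately have "open (((\<lambda>s. a + s *s b) \<circ> (\<lambda>t. of_real r * cis t)) -` {z \<in> D. u z < c})"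
    by (intro open_vimage)
  then show "{t \<in> space borel. u (a + (of_real r * cis t) *s b) < c} \<in> sets borel"
    using assms(3) by (simp add: vimage_def)
qed

lemma plurisubharmonic_on_cong:
  assumes "open D" "plurisubharmonic_on D u" "\<And>x. x \<in> D \<Longrightarrow> v x = u x"
  shows "plurisubharmonic_on D v"
  unfolding plurisubharmonic_on_iff[OF assms(1)]
proof (intro conjI ballI allI)
  have "{z \<in> D. v z < c} = {z \<in> D. u z < c}" for c
    using assms(3) by auto
  then show "usc_on D v"
    using assms by (simp add: plurisubharmonic_on_def usc_on_def)
  fix a b assume a: "a \<in> D"
  have "\<forall>\<^sub>F r in at_right 0. u a \<le> circle_mean (\<lambda>s. u (a + s *s b)) 0 r"
    by (rule plurisubharmonic_on_submean[OF assms(1,2) a])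
  then show "\<forall>\<^sub>F r in at_right 0. v a \<le> circle_mean (\<lambda>s. v (a + s *s b)) 0 r"
    using eventually_circle_in[OF assms(1) a, of b] eventually_at_right_less[of 0]
  proof eventually_elim
    case (elim r)
    then have "circle_mean (\<lambda>s. v (a + s *s b)) 0 r = circle_mean (\<lambda>s. u (a + s *s b)) 0 r"
      by (intro circle_mean_cong) (simp add: norm_mult assms(3))
    with elim show ?case
      using assms(3)[OF a] by simp
  qed
qed

lemma plurisubharmonic_on_subset:
  assumes "open D" "plurisubharmonic_on D u" "open V" "V \<subseteq> D"
  shows "plurisubharmonic_on V u"
proof -
  have "{z \<in> V. u z < c} = V \<inter> {z \<in> D. u z < c}" for c
    using assms(4) by auto
  then show ?thesis
    using assms by (auto simp: plurisubharmonic_on_iff usc_on_open_iff subset_iff)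
qed

lemma plurisubharmonic_on_local:
  assumes D: "open D"
    and loc: "\<And>x. x \<in> D \<Longrightarrow> \<exists>V. open V \<and> x \<in> V \<and> V \<subseteq> D \<and> plurisubharmonic_on V u"
  shows "plurisubharmonic_on D u"
  unfolding plurisubharmonic_on_iff[OF D] usc_on_open_iff[OF D]
proof (intro conjI ballI allI)
  fix z assume "z \<in> D" then show "u z < \<infinity>"
    using loc by (meson plurisubharmonic_on_def usc_on_def)
next
  fix c
  show "open {z \<in> D. u z < c}"
    unfolding open_subopen[of "{z \<in> D. u z < c}"]
  proof clarify
    fix x assume "x \<in> D" "u x < c"
    with loc obtain V where "open V" "x \<in> V" "V \<subseteq> D" "plurisubharmonic_on V u"
      by blast
    then have "open {z \<in> V. u z < c}"
      using plurisubharmonic_on_iff usc_on_open_iff by blast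
    with \<open>x \<in> V\<close> \<open>V \<subseteq> D\<close> \<open>u x < c\<close> show "\<exists>T. open T \<and> x \<in> T \<and> T \<subseteq> {z \<in> D. u z < c}"
      by blast
  qed
next
  fix a b assume "a \<in> D"
  then show "\<forall>\<^sub>F r in at_right 0. u a \<le> circle_mean (\<lambda>s. u (a + s *s b)) 0 r"
    using loc plurisubharmonic_on_iff by blast
qed

lemma plurisubharmonic_on_max:
  assumes D: "open D" and "plurisubharmonic_on D u" "plurisubharmonic_on D v"
  shows "plurisubharmonic_on D (\<lambda>x. max (u x) (v x))"
  unfolding plurisubharmonic_on_iff[OF D]
proof (intro conjI ballI allI)
  have "{z \<in> D. max (u z) (v z) < c} = {z \<in> D. u z < c} \<inter> {z \<in> D. v z < c}" for c
    by auto
  then show "usc_on D (\<lambda>x. max (u x) (v x))"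
    using assms by (auto simp: plurisubharmonic_on_iff usc_on_open_iff max_def)
  fix a b assume a: "a \<in> D"
  have "\<forall>\<^sub>F r in at_right 0. u a \<le> circle_mean (\<lambda>s. u (a + s *s b)) 0 r"
       "\<forall>\<^sub>F r in at_right 0. v a \<le> circle_mean (\<lambda>s. v (a + s *s b)) 0 r"
    by (rule plurisubharmonic_on_submean[OF D assms(2) a] plurisubharmonic_on_submean[OF D assms(3) a])+
  then show "\<forall>\<^sub>F r in at_right 0. max (u a) (v a)
               \<le> circle_mean (\<lambda>s. max (u (a + s *s b)) (v (a + s *s b))) 0 r"
  proof eventually_elim
    case (elim r)
    have "circle_mean (\<lambda>s. u (a + s *s b)) 0 r \<le> circle_mean (\<lambda>s. max (u (a + s *s b)) (v (a + s *s b))) 0 r"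
         "circle_mean (\<lambda>s. v (a + s *s b)) 0 r \<le> circle_mean (\<lambda>s. max (u (a + s *s b)) (v (a + s *s b))) 0 r"
      by (rule circle_mean_mono; simp)+
    with elim show ?case
      by auto
  qed
qed

lemma log_ereal_nonpos: "x \<le> 1 \<Longrightarrow> 0 \<le> x \<Longrightarrow> log_ereal x \<le> 0"
  by (auto simp: log_ereal_def)

lemma log_ereal_less_iff: "x \<ge> 0 \<Longrightarrow> log_ereal x < ereal c \<longleftrightarrow> x < exp c"
  using ln_less_cancel_iff[of x "exp c"] by (auto simp: log_ereal_def)

lemma log_ereal_max:
  assumes "x \<ge> 0" "y \<ge> 0"
  shows "log_ereal (max x y) = max (log_ereal x) (log_ereal y)"
  using assms by (auto simp: log_ereal_def max_def)

text \<open>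
  Scaling by \<open>\<kappa>\<close> adds the constant \<open>ln \<kappa>\<close> to the logarithm. The bounds on \<open>u\<close> and \<open>\<kappa>\<close> place this in
  the range of \<open>circle_mean_nonpos_diff\<close>.
\<close>

lemma plurisubharmonic_on_log_scale:
  assumes D: "open D" and psh: "plurisubharmonic_on D (\<lambda>x. log_ereal (u x))"
    and u: "\<And>x. x \<in> D \<Longrightarrow> 0 \<le> u x \<and> u x \<le> 1" and \<kappa>: "0 < \<kappa>" "\<kappa> \<le> 1"
  shows "plurisubharmonic_on D (\<lambda>x. log_ereal (\<kappa> * u x))"
proof (rule plurisubharmonic_on_cong[OF D])
  define c where "c = - ln \<kappa>"
  have c: "c \<ge> 0"
    using \<kappa> by (simp add: c_def)
  show "log_ereal (\<kappa> * u x) = log_ereal (u x) - ereal c" if "x \<in> D" for x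
    using u[OF that] \<kappa> by (auto simp: log_ereal_def c_def ln_mult)
  show "plurisubharmonic_on D (\<lambda>x. log_ereal (u x) - ereal c)"
    unfolding plurisubharmonic_on_iff[OF D]
  proof (intro conjI ballI allI)
    have "log_ereal (u z) - ereal c < d \<longleftrightarrow> log_ereal (u z) < d + ereal c" for d z
      by (cases "log_ereal (u z)"; cases d) auto
    moreover have "log_ereal (u z) - ereal c < \<infinity>" for z
      by (simp add: log_ereal_def)
    ultimately show "usc_on D (\<lambda>x. log_ereal (u x) - ereal c)"
      using psh by (auto simp: plurisubharmonic_on_iff[OF D] usc_on_open_iff[OF D])
    fix a b assume a: "a \<in> D"
    have usc: "usc_on D (\<lambda>x. log_ereal (u x))"
      using psh by (simp add: plurisubharmonic_on_def)
    have "\<forall>\<^sub>F r in at_right 0. log_ereal (u a) \<le> circle_mean (\<lambda>s. log_ereal (u (a + s *s b))) 0 r"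
      by (rule plurisubharmonic_on_submean[OF D psh a])
    then show "\<forall>\<^sub>F r in at_right 0. log_ereal (u a) - ereal c
                 \<le> circle_mean (\<lambda>s. log_ereal (u (a + s *s b)) - ereal c) 0 r"
      using eventually_circle_in[OF D a, of b] eventually_at_right_less[of 0]
    proof eventually_elim
      case (elim r)
      then have in_D: "a + (of_real r * cis t) *s b \<in> D" for t
        by (simp add: norm_mult)
      have "circle_mean (\<lambda>s. log_ereal (u (a + s *s b)) - ereal c) 0 r
              = circle_mean (\<lambda>s. log_ereal (u (a + s *s b))) 0 r - ereal c"
        using usc_on_circle_measurable[OF D usc in_D] u[OF in_D] c
        by (intro circle_mean_nonpos_diff) (auto intro: log_ereal_nonpos)
      with elim show ?case
        by (simp add: ereal_minus_mono)
    qed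
  qed
qed

lemma plurisubharmonic_on_exp:
  assumes D: "open D" and cont: "continuous_on D \<rho>"
    and psh: "plurisubharmonic_on D (\<lambda>x. ereal (\<rho> x))" and A: "A > 0"
  shows "plurisubharmonic_on D (\<lambda>x. log_ereal (exp (A * (\<rho> x - c))))"
  unfolding plurisubharmonic_on_iff[OF D]
proof (intro conjI ballI allI)
  have log: "log_ereal (exp (A * (\<rho> x - c))) = ereal (A * (\<rho> x - c))" for x
    by (simp add: log_ereal_def)
  show "usc_on D (\<lambda>x. log_ereal (exp (A * (\<rho> x - c))))"
    unfolding usc_on_open_iff[OF D] log
  proof (intro conjI allI ballI)
    fix d
    have "{x \<in> D. ereal (A * (\<rho> x - c)) < d} = D \<inter> (\<lambda>x. ereal (A * (\<rho> x - c))) -` {..<d}"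
      by auto
    also have "open \<dots>"
      by (intro continuous_open_preimage continuous_intros cont D)
    finally show "open {x \<in> D. ereal (A * (\<rho> x - c)) < d}" .
  qed auto
  fix a b assume a: "a \<in> D"
  have "\<forall>\<^sub>F r in at_right 0. ereal (\<rho> a) \<le> circle_mean (\<lambda>s. ereal (\<rho> (a + s *s b))) 0 r"
    by (rule plurisubharmonic_on_submean[OF D psh a])
  then show "\<forall>\<^sub>F r in at_right 0. log_ereal (exp (A * (\<rho> a - c)))
               \<le> circle_mean (\<lambda>s. log_ereal (exp (A * (\<rho> (a + s *s b) - c)))) 0 r"
    unfolding log using eventually_circle_in[OF D a, of b] eventually_at_right_less[of 0]
  proof eventually_elim
    case (elim r)
    have cs: "continuous_on (sphere 0 r) (\<lambda>s. \<rho> (a + s *s b))"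
      using elim by (intro continuous_on_compose2[OF cont continuous_on_line]) auto
    define g where "g t = \<rho> (a + (of_real r * cis t) *s b)" for t
    have "continuous_on {0..2*pi} g"
      unfolding g_def using elim
      by (intro continuous_on_compose2[OF cs] continuous_intros) (auto simp: norm_mult)
    then have "g integrable_on {0..2*pi}"
      by (rule integrable_continuous_real)
    then have I: "integral {0..2*pi} (\<lambda>t. g t - c) = integral {0..2*pi} g - 2*pi*c"
      using integral_diff[OF _ integrable_const_ivl[of c 0 "2*pi", simplified]] by simp
    have "\<rho> a \<le> integral {0..2*pi} g / (2*pi)"
      using elim circle_mean_real[OF cs] by (simp add: g_def[abs_def])
    then have "\<rho> a - c \<le> (integral {0..2*pi} g - 2*pi*c) / (2*pi)"
      by (simp add: field_simps)
    then have "A * (\<rho> a - c) \<le> A * ((integral {0..2*pi} g - 2*pi*c) / (2*pi))"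
      using A by (intro mult_left_mono) auto
    moreover have "circle_mean (\<lambda>s. ereal (A * (\<rho> (a + s *s b) - c))) 0 r
        = ereal (integral {0..2*pi} (\<lambda>t. A * (g t - c)) / (2*pi))"
      using elim by (subst circle_mean_real) (auto intro!: continuous_intros cs simp: g_def)
    ultimately show ?case
      by (simp add: I)
  qed
qed


text \<open>The Cauchy--Schwarz inequality for the Hermitian product.\<close>

lemma norm_inner_vec_le:
  fixes x e :: "complex ^ 'm"
  shows "cmod (\<Sum>i\<in>UNIV. x $ i * cnj (e $ i)) \<le> norm x * norm e"
proof -
  have "cmod (\<Sum>i\<in>UNIV. x $ i * cnj (e $ i)) \<le> (\<Sum>i\<in>UNIV. \<bar>norm (x $ i)\<bar> * \<bar>norm (e $ i)\<bar>)"
    by (rule order_trans[OF norm_sum]) (simp add: norm_mult)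
  also have "\<dots> \<le> norm x * norm e"
    unfolding norm_vec_def by (rule L2_set_mult_ineq)
  finally show ?thesis .
qed

text \<open>
  Where \<open>a \<noteq> w\<close>, the norm of a vector dominates the modulus of its component in the direction of
  \<open>a - w\<close>, with equality at \<open>a\<close>. Along a line this component is an affine function of \<open>s\<close> without
  zeros near \<open>0\<close>, whose log-modulus has the mean value property. So the logarithm of the norm lies
  above a function with the mean value property and touches it at the centre.
\<close>

lemma plurisubharmonic_on_log_norm:
  fixes w :: "complex ^ 'm"
  assumes R: "R > 0"
  shows "plurisubharmonic_on UNIV (\<lambda>x. log_ereal (norm (x - w) / R))"
  unfolding plurisubharmonic_on_iff[OF open_UNIV]
proof (intro conjI ballI allI)
  show "usc_on UNIV (\<lambda>x. log_ereal (norm (x - w) / R))"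
    unfolding usc_on_open_iff[OF open_UNIV]
  proof (intro conjI allI ballI)
    fix z show "log_ereal (norm (z - w) / R) < \<infinity>"
      by (simp add: log_ereal_def)
  next
    fix c
    show "open {z \<in> UNIV. log_ereal (norm (z - w) / R) < c}"
    proof (cases c)
      case (real d)
      have "{z \<in> UNIV. log_ereal (norm (z - w) / R) < c} = {z. norm (z - w) / R < exp d}"
        using R by (simp add: real log_ereal_less_iff)
      also have "open \<dots>"
        using R by (intro open_Collect_less continuous_intros) auto
      finally show ?thesis .
    next
      case PInf
      have "{z \<in> UNIV. log_ereal (norm (z - w) / R) < c} = UNIV"
        by (auto simp: PInf log_ereal_def)
      then show ?thesis by simp
    qed simp
  qed
next
  fix a b :: "complex ^ 'm"
  show "\<forall>\<^sub>F r in at_right 0. log_ereal (norm (a - w) / R)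
          \<le> circle_mean (\<lambda>s. log_ereal (norm (a + s *s b - w) / R)) 0 r"
  proof (cases "a = w")
    case True
    then show ?thesis by (simp add: log_ereal_def)
  next
    case False
    \<comment> \<open>\<open>p + s * \<beta>\<close> is the component of \<open>a + s *s b - w\<close> in the direction \<open>(a - w) / p\<close>.\<close>
    define p where "p = norm (a - w)"
    define \<beta> where "\<beta> = (\<Sum>i\<in>UNIV. b $ i * cnj ((a - w) $ i)) / of_real p"
    have p: "p > 0"
      using False by (simp add: p_def)
    have "(\<Sum>i\<in>UNIV. (a - w) $ i * cnj ((a - w) $ i)) = of_real (p\<^sup>2)"
      unfolding p_def norm_vec_def L2_set_def
      by (simp add: sum_nonneg complex_norm_square[symmetric] del: vector_minus_component complex_cnj_diff)
    moreover have "(a + s *s b - w) $ i * cnj ((a - w) $ i)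
        = (a - w) $ i * cnj ((a - w) $ i) + s * (b $ i * cnj ((a - w) $ i))" for s i
      by (simp add: algebra_simps)
    moreover have "(\<Sum>i\<in>UNIV. b $ i * cnj ((a - w) $ i)) = of_real p * \<beta>"
      using p by (simp add: \<beta>_def)
    ultimately have inner: "(\<Sum>i\<in>UNIV. (a + s *s b - w) $ i * cnj ((a - w) $ i))
        = of_real p * (of_real p + s * \<beta>)" for s
      by (simp only: sum.distrib flip: sum_distrib_left) (simp add: algebra_simps power2_eq_square)
    have lower: "cmod (of_real p + s * \<beta>) \<le> norm (a + s *s b - w)" for s
    proof -
      have "p * cmod (of_real p + s * \<beta>) \<le> norm (a + s *s b - w) * p"
        using norm_inner_vec_le[of "a + s *s b - w" "a - w"] p
        unfolding inner p_def[symmetric] by (simp add: norm_mult)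
      then show ?thesis
        using p by simp
    qed
    have "\<forall>\<^sub>F r in at_right 0. r * cmod \<beta> < p"
      using p by (intro order_tendstoD(2)[of _ 0] tendsto_eq_intros) auto
    then show ?thesis
      using eventually_at_right_less[of 0]
    proof eventually_elim
      case (elim r)
      have pos: "cmod (of_real p + s * \<beta>) > 0" if "cmod s = r" for s
      proof -
        have "p - cmod (s * \<beta>) \<le> cmod (of_real p + s * \<beta>)"
          using norm_diff_ineq[of "of_real p" "s * \<beta>"] p by simp
        then show ?thesis
          using elim that by (simp add: norm_mult del: zero_less_norm_iff)
      qed
      have c: "continuous_on (sphere 0 r) (\<lambda>s. ln (cmod (of_real p + s * \<beta>) / R))"
        using pos R by (auto intro!: continuous_intros)
      have c': "continuous_on {0..2*pi} (\<lambda>t. ln (cmod (of_real p + (of_real r * cis t) * \<beta>)))"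
        using pos elim by (auto intro!: continuous_intros simp: norm_mult)
      have "integral {0..2*pi} (\<lambda>t. ln (cmod (of_real p + (of_real r * cis t) * \<beta>) / R))
              = integral {0..2*pi} (\<lambda>t. ln (cmod (of_real p + (of_real r * cis t) * \<beta>)) - ln R)"
        using pos[of "of_real r * cis _"] R elim by (intro integral_cong) (auto simp: norm_mult ln_div)
      also have "\<dots> = 2*pi * ln p - 2*pi * ln R"
        using log_mean_value[of p r \<beta>] p elim
          integral_diff[OF integrable_continuous_real[OF c']
            integrable_const_ivl[of "ln R" 0 "2*pi", simplified]] by simp
      finally have "ereal (ln (p / R)) = circle_mean (\<lambda>s. ereal (ln (cmod (of_real p + s * \<beta>) / R))) 0 r"
        using p R elim by (subst circle_mean_real[OF c]) (auto simp: ln_div field_simps)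
      also have "\<dots> \<le> circle_mean (\<lambda>s. log_ereal (norm (a + s *s b - w) / R)) 0 r"
      proof (rule circle_mean_mono)
        fix t
        let ?s = "0 + of_real r * cis t :: complex"
        have "0 < cmod (of_real p + ?s * \<beta>)"
          using elim by (intro pos) (simp add: norm_mult)
        with lower[of ?s] R show "ereal (ln (cmod (of_real p + ?s * \<beta>) / R)) \<le> log_ereal (norm (a + ?s *s b - w) / R)"
          by (auto simp: log_ereal_def divide_right_mono)
      qed
      finally show ?case
        using p R by (simp add: log_ereal_def p_def)
    qed
  qed
qed


section \<open>Gluing\<close>

definition max_glue :: "'a set \<Rightarrow> ('a \<Rightarrow> real) \<Rightarrow> ('a \<Rightarrow> real) \<Rightarrow> 'a \<Rightarrow> real" where
  "max_glue U u v x = (if x \<in> U then max (u x) (v x) else v x)"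

text \<open>
  Near a point outside \<open>U\<close> the second function wins, so the glued function is just \<open>v\<close> there; on \<open>U\<close>
  it is a maximum of two functions with plurisubharmonic logarithms. Locality does the rest.
\<close>

lemma plurisubharmonic_on_max_glue:
  assumes W: "open W" and U: "open U" "U \<subseteq> W"
    and u: "plurisubharmonic_on U (\<lambda>x. log_ereal (u x))" "\<And>x. x \<in> U \<Longrightarrow> 0 \<le> u x"
    and v: "plurisubharmonic_on W (\<lambda>x. log_ereal (v x))" "\<And>x. x \<in> W \<Longrightarrow> 0 \<le> v x"
    and edge: "\<And>x. x \<in> W - U \<Longrightarrow> \<exists>N. open N \<and> x \<in> N \<and> (\<forall>y\<in>N \<inter> U. u y \<le> v y)"
  shows "plurisubharmonic_on W (\<lambda>x. log_ereal (max_glue U u v x))"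
proof (rule plurisubharmonic_on_local[OF W])
  fix x assume x: "x \<in> W"
  show "\<exists>V. open V \<and> x \<in> V \<and> V \<subseteq> W \<and> plurisubharmonic_on V (\<lambda>x. log_ereal (max_glue U u v x))"
  proof (cases "x \<in> U")
    case True
    have "plurisubharmonic_on U (\<lambda>x. max (log_ereal (u x)) (log_ereal (v x)))"
      using plurisubharmonic_on_subset[OF W v(1) U] by (intro plurisubharmonic_on_max U u)
    then have "plurisubharmonic_on U (\<lambda>x. log_ereal (max_glue U u v x))"
      by (rule plurisubharmonic_on_cong[OF U(1)])
         (use u(2) v(2) U in \<open>auto simp: max_glue_def log_ereal_max\<close>)
    with True U show ?thesis by blast
  next
    case False
    with x edge[of x] obtain N where N: "open N" "x \<in> N" "\<And>y. y \<in> N \<inter> U \<Longrightarrow> u y \<le> v y"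
      by blast
    have "plurisubharmonic_on (N \<inter> W) (\<lambda>x. log_ereal (v x))"
      using W N by (intro plurisubharmonic_on_subset[OF W v(1)]) auto
    then have "plurisubharmonic_on (N \<inter> W) (\<lambda>x. log_ereal (max_glue U u v x))"
      by (rule plurisubharmonic_on_cong[rotated]) (use N W in \<open>auto simp: max_glue_def max_absorb2\<close>)
    with N x W show ?thesis by (intro exI[of _ "N \<inter> W"]) auto
  qed
qed


section \<open>Monotonicity of the Green function\<close>

lemma green_upper:
  assumes "u \<in> green_candidates D w" "z \<in> D"
  shows "u z \<le> green D z w"
  unfolding green_def using assms
  by (intro cSUP_upper bdd_aboveI[of _ 1]) (auto simp: green_candidates_def less_imp_le)

lemma zero_green_candidate:
  assumes "open D" "w \<in> D"
  shows "(\<lambda>_. 0) \<in> green_candidates D w"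
proof -
  obtain r where "r > 0" "ball w r \<subseteq> D"
    using assms open_contains_ball by blast
  moreover have "{z \<in> D. - \<infinity> < c} = (if c = - \<infinity> then {} else D)" for c :: ereal
    by auto
  ultimately show ?thesis
    using assms(1)
    by (auto simp: green_candidates_def plurisubharmonic_on_iff usc_on_open_iff log_ereal_def
             simp del: ereal_infty_less intro!: exI[of _ 1] exI[of _ r])
qed

lemma green_least:
  assumes "open D" "w \<in> D" "\<And>u. u \<in> green_candidates D w \<Longrightarrow> u z \<le> B"
  shows "green D z w \<le> B"
  unfolding green_def
proof (rule cSUP_least)
  show "green_candidates D w \<noteq> {}"
    using zero_green_candidate[OF assms(1,2)] by blast
qed (rule assms(3))

lemma green_antimono:
  assumes "open D" "open D'" "D \<subseteq> D'" "w \<in> D" "z \<in> D"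
  shows "green D' z w \<le> green D z w"
proof (rule green_least)
  fix u assume u: "u \<in> green_candidates D' w"
  then obtain M r where Mr: "M > 0" "r > 0" "\<forall>\<zeta>\<in>ball w r. u \<zeta> \<le> M * norm (\<zeta> - w)"
    by (auto simp: green_candidates_def)
  obtain r' where r': "r' > 0" "ball w r' \<subseteq> D"
    using assms open_contains_ball by blast
  have "plurisubharmonic_on D' (\<lambda>x. log_ereal (u x))"
    using u by (simp add: green_candidates_def)
  then have "plurisubharmonic_on D (\<lambda>x. log_ereal (u x))"
    by (rule plurisubharmonic_on_subset[OF assms(2) _ assms(1,3)])
  moreover have "ball w (min r r') \<subseteq> D \<and> (\<forall>\<zeta>\<in>ball w (min r r'). u \<zeta> \<le> M * norm (\<zeta> - w))"
    using Mr r' by (auto simp: subset_iff)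
  moreover have "\<forall>x\<in>D. 0 \<le> u x \<and> u x < 1"
    using u assms(3) by (auto simp: green_candidates_def)
  ultimately have "u \<in> green_candidates D w"
    unfolding green_candidates_def mem_Collect_eq using Mr(1,2) r'(1)
    by (intro conjI exI[of _ M] exI[of _ "min r r'"]) simp_all
  then show "u z \<le> green D z w"
    using assms(5) by (rule green_upper)
qed (use assms in auto)


section \<open>Green functions of nearby sublevel sets\<close>

lemma open_sublevel:
  fixes f :: "'a::topological_space \<Rightarrow> real"
  assumes "open S" "continuous_on S f"
  shows "open {x \<in> S. f x < t}"
  using continuous_open_preimage[OF assms(2,1), of "{..<t}"]
  by (simp add: vimage_def Collect_conj_eq)

text \<open>
  The smallness of \<open>b - a\<close> keeps the collar \<open>2 * a - b < \<rho>\<close> around the boundary of \<open>S a\<close> away from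
  the ball around \<open>w\<close> on which the lower bound \<open>H \<ge> exp (A * (\<rho> - b))\<close> may fail. The constant \<open>A\<close> is
  subject to conditions without \<open>a\<close> and \<open>b\<close>, so the factor tends to \<open>1\<close> as \<open>b - a\<close> tends to \<open>0\<close>.
\<close>

lemma green_sublevel_le:
  fixes \<Omega> :: "(complex ^ 'm) set" and \<rho> :: "complex ^ 'm \<Rightarrow> real"
  defines "S t \<equiv> {x \<in> \<Omega>. \<rho> x < t}"
  assumes \<Omega>: "open \<Omega>" and cont: "continuous_on \<Omega> \<rho>"
    and psh: "plurisubharmonic_on \<Omega> (\<lambda>x. ereal (\<rho> x))"
    and R: "\<And>x. x \<in> \<Omega> \<Longrightarrow> norm (x - w) < R"
    and r: "r > 0" "cball w r \<subseteq> \<Omega>" and c0: "c0 > 0" "\<And>x. x \<in> cball w r \<Longrightarrow> \<rho> x \<le> - c0"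
    and A: "A > 0" "exp (- A * c0) \<le> r / (2 * R)"
    and ab: "0 \<le> b" "a < b" "2 * (b - a) \<le> b + c0"
    and z: "z \<in> S a"
  shows "green (S a) z w \<le> exp (2 * A * (b - a)) * green (S b) z w"
proof -
  note S_open = open_sublevel[OF \<Omega> cont, folded S_def]
  have w: "w \<in> \<Omega>"
    using r by auto
  have Rpos: "R > 0"
    using R[OF w] by simp
  have S_mono: "S a \<subseteq> S b"
    using ab by (auto simp: S_def)
  have cball_a: "cball w r \<subseteq> S a"
    using c0 r ab by (force simp: S_def)
  define E where "E x = exp (A * (\<rho> x - b))" for x
  define L where "L x = norm (x - w) / R" for x
  define H where "H = max_glue (S b - cball w (r/2)) E L"
  define \<kappa> where "\<kappa> = exp (- 2 * A * (b - a))"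
  have \<kappa>: "0 < \<kappa>" "\<kappa> \<le> 1"
    using A ab by (auto simp: \<kappa>_def)
  have L01: "0 \<le> L x" "x \<in> \<Omega> \<Longrightarrow> L x < 1" for x
    using R[of x] Rpos by (auto simp: L_def)
  have H01: "0 \<le> H x" "x \<in> S b \<Longrightarrow> H x < 1" for x
    using L01[of x] A by (auto simp: H_def max_glue_def E_def S_def le_max_iff_disj mult_pos_neg)
  have psh_H: "plurisubharmonic_on (S b) (\<lambda>x. log_ereal (H x))"
    unfolding H_def
  proof (rule plurisubharmonic_on_max_glue)
    show "plurisubharmonic_on (S b) (\<lambda>x. log_ereal (L x))"
      unfolding L_def
      by (rule plurisubharmonic_on_subset[OF open_UNIV plurisubharmonic_on_log_norm[OF Rpos]])
         (auto simp: S_open)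
    have "plurisubharmonic_on \<Omega> (\<lambda>x. log_ereal (E x))"
      unfolding E_def by (intro plurisubharmonic_on_exp \<Omega> cont psh A)
    then show "plurisubharmonic_on (S b - cball w (r/2)) (\<lambda>x. log_ereal (E x))"
      by (rule plurisubharmonic_on_subset[OF \<Omega>]) (auto simp: S_open open_Diff, auto simp: S_def)
  next
    fix x assume x: "x \<in> S b - (S b - cball w (r/2))"
    \<comment> \<open>The pieces of \<open>H\<close> overlap in the annulus \<open>r/2 < dist w y < r\<close>, where \<open>L\<close> wins by the choice of
      \<open>A\<close> and by \<open>b \<ge> 0\<close>.\<close>
    have "E y \<le> L y" if y: "y \<in> ball w r - cball w (r/2)" for y
    proof -
      have "\<rho> y - b \<le> - c0"
        using c0(2)[of y] y ab by simp
      then have "A * (\<rho> y - b) \<le> A * (- c0)"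
        using A by (intro mult_left_mono) auto
      then have "E y \<le> exp (- A * c0)"
        by (simp add: E_def)
      also have "\<dots> \<le> r / (2 * R)"
        by (rule A)
      also have "\<dots> \<le> L y"
        using y Rpos by (simp add: L_def field_simps dist_norm norm_minus_commute)
      finally show ?thesis .
    qed
    then show "\<exists>N. open N \<and> x \<in> N \<and> (\<forall>y\<in>N \<inter> (S b - cball w (r/2)). E y \<le> L y)"
      using x r by (intro exI[of _ "ball w r"]) auto
  qed (auto simp: S_open E_def L01)
  have key: "\<kappa> * u z \<le> green (S b) z w" if u: "u \<in> green_candidates (S a) w" for u
  proof -
    define V where "V = max_glue (S a) (\<lambda>x. \<kappa> * u x) H"
    have u01: "0 \<le> u x" "u x < 1" if "x \<in> S a" for x
      using u that by (auto simp: green_candidates_def)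
    have \<kappa>u: "\<kappa> * u x \<le> \<kappa>" if "x \<in> S a" for x
      using u01[OF that] \<kappa> mult_left_le by fastforce
    have "plurisubharmonic_on (S b) (\<lambda>x. log_ereal (V x))"
      unfolding V_def
    proof (rule plurisubharmonic_on_max_glue)
      show "plurisubharmonic_on (S a) (\<lambda>x. log_ereal (\<kappa> * u x))"
        using u u01 \<kappa> by (intro plurisubharmonic_on_log_scale)
          (auto simp: S_open green_candidates_def less_imp_le)
    next
      fix x assume x: "x \<in> S b - S a"
      \<comment> \<open>In this collar \<open>\<rho> - b > - 2 * (b - a)\<close>, which makes \<open>E\<close> exceed \<open>\<kappa>\<close>.\<close>
      let ?N = "\<Omega> \<inter> \<rho> -` {2 * a - b<..}"
      have "\<kappa> * u y \<le> H y" if y: "y \<in> ?N \<inter> S a" for y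
      proof -
        have "y \<notin> cball w r"
          using c0(2)[of y] y ab by auto
        then have "y \<in> S b - cball w (r/2)"
          using y S_mono r by auto
        then have "E y \<le> H y"
          by (simp add: H_def max_glue_def)
        moreover have "A * (- 2 * (b - a)) \<le> A * (\<rho> y - b)"
          using y A by (intro mult_left_mono) auto
        then have "\<kappa> \<le> E y"
          by (simp add: \<kappa>_def E_def algebra_simps)
        ultimately show ?thesis
          using \<kappa>u[of y] y by simp
      qed
      moreover have "open ?N" "x \<in> ?N"
        using continuous_open_preimage[OF cont \<Omega>] x ab by (auto simp: S_def)
      ultimately show "\<exists>N. open N \<and> x \<in> N \<and> (\<forall>y\<in>N \<inter> S a. \<kappa> * u y \<le> H y)"
        by blast
    qed (use \<kappa> u01 S_mono psh_H in \<open>auto simp: S_open H01\<close>)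
    moreover have "0 \<le> V x \<and> V x < 1" if "x \<in> S b" for x
    proof -
      have "\<kappa> * u x < 1" if "x \<in> S a"
        using u01[OF that] \<kappa> mult_left_le_one_le[of "u x" \<kappa>] by linarith
      then show ?thesis
        using H01[of x] that by (auto simp: V_def max_glue_def le_max_iff_disj)
    qed
    moreover have "\<exists>M>0. \<exists>r>0. ball w r \<subseteq> S b \<and> (\<forall>\<zeta>\<in>ball w r. V \<zeta> \<le> M * norm (\<zeta> - w))"
    proof -
      obtain M s where Ms: "M > 0" "s > 0" "ball w s \<subseteq> S a" "\<forall>\<zeta>\<in>ball w s. u \<zeta> \<le> M * norm (\<zeta> - w)"
        using u by (auto simp: green_candidates_def)
      let ?s = "min s (r/2)" and ?M = "max M (1 / R)"
      have "V y \<le> ?M * norm (y - w)" if y: "y \<in> ball w ?s" for y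
      proof -
        have "y \<in> S a"
          using Ms y by auto
        have "\<kappa> * u y \<le> 1 * u y"
          using \<kappa> u01[OF \<open>y \<in> S a\<close>] by (intro mult_right_mono) auto
        also have "\<dots> \<le> M * norm (y - w)"
          using Ms y by simp
        also have "\<dots> \<le> ?M * norm (y - w)"
          by (intro mult_right_mono) auto
        finally have "\<kappa> * u y \<le> ?M * norm (y - w)" .
        moreover have "H y = 1 / R * norm (y - w)"
          using y by (auto simp: H_def max_glue_def L_def)
        moreover have "1 / R * norm (y - w) \<le> ?M * norm (y - w)"
          by (intro mult_right_mono) auto
        ultimately show ?thesis
          by (simp add: V_def max_glue_def)
      qed
      moreover have "ball w ?s \<subseteq> S b"
        using Ms S_mono by auto
      moreover have "?M > 0" "?s > 0"
        using Ms r by auto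
      ultimately show ?thesis
        by blast
    qed
    ultimately have "V \<in> green_candidates (S b) w"
      unfolding green_candidates_def by blast
    then have "V z \<le> green (S b) z w"
      using z S_mono by (intro green_upper) auto
    then show ?thesis
      using z by (simp add: V_def max_glue_def)
  qed
  have "u z \<le> exp (2 * A * (b - a)) * green (S b) z w" if u: "u \<in> green_candidates (S a) w" for u
  proof -
    have "u z = exp (2 * A * (b - a)) * (\<kappa> * u z)"
      by (simp add: \<kappa>_def flip: exp_add mult.assoc)
    also have "\<dots> \<le> exp (2 * A * (b - a)) * green (S b) z w"
      using key[OF u] by (intro mult_left_mono) auto
    finally show ?thesis .
  qed
  moreover have "w \<in> S a"
    using cball_a r by auto
  ultimately show ?thesis
    by (intro green_least S_open)
qed


section \<open>Convergence\<close>

text \<open>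
  Boundedness and nonemptiness ensure that the infimum defining the distance is taken over a
  nonempty set.
\<close>

lemma hausdorff_distance_lessD:
  assumes "bounded A" "bounded B" "A \<noteq> {}" "B \<noteq> {}" "hausdorff_distance A B < \<delta>"
  shows "A \<subseteq> thickening B \<delta>"
proof -
  let ?X = "{\<delta>. \<delta> > 0 \<and> A \<subseteq> thickening B \<delta> \<and> B \<subseteq> thickening A \<delta>}"
  obtain d where d: "\<forall>x\<in>A \<union> B. \<forall>y\<in>A \<union> B. dist x y \<le> d"
    using assms(1,2) bounded_two_points[of "A \<union> B"] by auto
  obtain a b where ab: "a \<in> A" "b \<in> B"
    using assms by blast
  have "\<bar>d\<bar> + 1 \<in> ?X"
    using d ab by (force simp: thickening_def)
  then have "?X \<noteq> {}" by blast
  then obtain \<delta>' where "\<delta>' \<in> ?X" "\<delta>' < \<delta>"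
    using assms(5) cInf_lessD[of ?X \<delta>] by (auto simp: hausdorff_distance_def)
  then show ?thesis
    by (force simp: thickening_def)
qed

theorem corollary2p6:
  fixes D \<Omega> :: "(complex ^ 'm) set"
    and \<rho> :: "complex ^ 'm \<Rightarrow> real"
    and Dn :: "nat \<Rightarrow> (complex ^ 'm) set"
    and z w :: "complex ^ 'm"
  assumes "strictly_hyperconvex D"
    and "strict_hyperconvexity_data D \<Omega> \<rho>"
    and "\<And>k::nat. k \<ge> 1 \<Longrightarrow> hyperconvex {x \<in> \<Omega>. \<rho> x < 1 / real k}"
    and "\<And>n. n \<ge> 1 \<Longrightarrow> bounded_domain (Dn n)"
    and "(\<lambda>n. hausdorff_distance (closure (Dn n)) (closure D)) \<longlonglongrightarrow> 0"
    and "\<And>K. compact K \<Longrightarrow> K \<subseteq> D \<Longrightarrow> \<exists>n0\<ge>1. \<forall>n\<ge>n0. K \<subseteq> Dn n"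
    and "z \<in> D" and "w \<in> D"
  shows "(\<lambda>n. green (Dn n) z w) \<longlonglongrightarrow> green D z w"
proof -
  define S where "S t = {x \<in> \<Omega>. \<rho> x < t}" for t
  note data = assms(2)[unfolded strict_hyperconvexity_data_def bounded_domain_def domain_def]
  have \<Omega>: "open \<Omega>" "bounded \<Omega>" and cont: "continuous_on \<Omega> \<rho>"
    and psh: "plurisubharmonic_on \<Omega> (\<lambda>x. ereal (\<rho> x))" and D: "D = S 0"
    using data by (auto simp: S_def)
  have rc: "compact (closure D)" "closure D \<subseteq> \<Omega>"
    using data by (auto simp: relatively_compact_in_def)
  note S_open = open_sublevel[OF \<Omega>(1) cont, folded S_def]
  have D_open: "open D"
    by (simp add: D S_open)
  have closure_le: "\<rho> x \<le> 0" if "x \<in> closure D" for x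
    by (rule continuous_le_on_closure[OF continuous_on_subset[OF cont rc(2)] that])
       (auto simp: D S_def)
  have K_compact: "compact {x \<in> \<Omega>. \<rho> x \<le> - s}" if "s > 0" for s
  proof -
    have "{x \<in> \<Omega>. \<rho> x \<le> - s} = closure D \<inter> \<rho> -` {..- s}"
      using rc(2) closure_subset[of D] that by (auto simp: D S_def)
    moreover have "closed (closure D \<inter> \<rho> -` {..- s})"
      by (intro continuous_closed_preimage continuous_on_subset[OF cont rc(2)]) auto
    ultimately show ?thesis
      using rc(1) by (metis compact_Int_closed inf.right_idem inf_commute inf_left_idem)
  qed
  obtain r where r: "r > 0" "cball w r \<subseteq> D"
    using D_open \<open>w \<in> D\<close> open_contains_cball by blast
  have "cball w r \<subseteq> \<Omega>"
    using r by (auto simp: D S_def)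
  obtain x0 where x0: "x0 \<in> cball w r" "\<And>x. x \<in> cball w r \<Longrightarrow> \<rho> x \<le> \<rho> x0"
    using continuous_attains_sup[of "cball w r" \<rho>] continuous_on_subset[OF cont \<open>cball w r \<subseteq> \<Omega>\<close>] r
    by auto
  define c0 where "c0 = - \<rho> x0"
  have c0: "c0 > 0" "\<And>x. x \<in> cball w r \<Longrightarrow> \<rho> x \<le> - c0"
    using x0 r by (auto simp: c0_def D S_def)
  obtain R0 where R0: "\<And>x. x \<in> \<Omega> \<Longrightarrow> norm (x - w) \<le> R0"
    using \<Omega>(2) bounded_any_center[of \<Omega> w] by (auto simp: dist_norm norm_minus_commute)
  define R where "R = max (R0 + 1) r"
  have R: "R > 0" "r \<le> R" "\<And>x. x \<in> \<Omega> \<Longrightarrow> norm (x - w) < R"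
    using r R0 by (fastforce simp: R_def)+
  \<comment> \<open>The solution of \<open>exp (- A * c0) = r / (2 * R)\<close>; it is positive because \<open>2 * R > r\<close>.\<close>
  define A where "A = ln (2 * R / r) / c0"
  have A: "A > 0" "exp (- A * c0) \<le> r / (2 * R)"
    using R r c0 by (auto simp: A_def exp_minus field_simps intro!: divide_pos_pos)
  note sublevel = green_sublevel_le[OF \<Omega>(1) cont psh R(3) r(1) \<open>cball w r \<subseteq> \<Omega>\<close> c0 A, folded S_def]
  \<comment> \<open>The comparison of sublevel sets is applied to the pairs \<open>(-s, 0)\<close> and \<open>(0, s)\<close>.\<close>
  have sandwich: "\<forall>\<^sub>F n in sequentially. exp (- 2 * A * s) * green D z w \<le> green (Dn n) z w
                    \<and> green (Dn n) z w \<le> exp (2 * A * s) * green D z w"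
    if s: "0 < s" "s < c0 / 2" "s < - \<rho> z" for s
  proof -
    have "closure D \<noteq> {}" "closure D \<subseteq> S s"
      using \<open>z \<in> D\<close> rc(2) closure_le s(1) by (force simp: S_def)+
    then obtain \<delta> where \<delta>: "\<delta> > 0" "{x. infdist x (closure D) \<le> \<delta>} \<subseteq> S s"
      using compact_in_open_separated[OF _ rc(1) S_open] by blast
    have thick: "thickening (closure D) \<delta> \<subseteq> S s"
    proof
      fix x assume "x \<in> thickening (closure D) \<delta>"
      then obtain y where "y \<in> closure D" "dist x y < \<delta>"
        by (auto simp: thickening_def dist_commute)
      then have "infdist x (closure D) \<le> \<delta>"
        using infdist_le[of y "closure D" x] by simp
      with \<delta>(2) show "x \<in> S s" by blast
    qed
    obtain n0 where n0: "\<And>n. n \<ge> n0 \<Longrightarrow> {x \<in> \<Omega>. \<rho> x \<le> - s} \<subseteq> Dn n"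
      using assms(6)[OF K_compact[OF s(1)]] s(1) by (fastforce simp: D S_def)
    have "\<forall>\<^sub>F n in sequentially. hausdorff_distance (closure (Dn n)) (closure D) < \<delta>"
      using assms(5) \<delta>(1) by (rule order_tendstoD)
    then show ?thesis
      using eventually_ge_at_top[of 1] eventually_ge_at_top[of n0]
    proof eventually_elim
      case (elim n)
      have dom: "open (Dn n)" "bounded (Dn n)" "Dn n \<noteq> {}"
        using assms(4)[OF elim(2)] by (auto simp: bounded_domain_def domain_def)
      have "closure (Dn n) \<subseteq> thickening (closure D) \<delta>"
        using elim dom rc(1) \<open>closure D \<noteq> {}\<close>
        by (intro hausdorff_distance_lessD) (auto simp: compact_imp_bounded)
      with thick have outer: "Dn n \<subseteq> S s"
        using closure_subset by blast
      have inner: "S (- s) \<subseteq> Dn n"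
        using n0[OF elim(3)] by (force simp: S_def)
      have "w \<in> cball w r"
        using r by simp
      then have zw: "z \<in> S (- s)" "w \<in> S (- s)"
        using \<open>z \<in> D\<close> \<open>w \<in> D\<close> s c0(2)[of w] by (auto simp: D S_def)
      have "green (Dn n) z w \<le> green (S (- s)) z w"
        using inner dom zw by (intro green_antimono S_open)
      also have "\<dots> \<le> exp (2 * A * s) * green D z w"
        using sublevel[of 0 "- s" z] s zw by (simp add: D)
      finally have upper: "green (Dn n) z w \<le> exp (2 * A * s) * green D z w" .
      have "green D z w \<le> exp (2 * A * s) * green (S s) z w"
        using sublevel[of s 0 z] s \<open>z \<in> D\<close> by (simp add: D)
      also have "\<dots> \<le> exp (2 * A * s) * green (Dn n) z w"
        using outer inner dom zw by (intro mult_left_mono green_antimono S_open) auto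
      finally have "exp (- 2 * A * s) * green D z w \<le> exp (- 2 * A * s) * (exp (2 * A * s) * green (Dn n) z w)"
        by (intro mult_left_mono) auto
      also have "\<dots> = green (Dn n) z w"
        by (simp flip: exp_add mult.assoc)
      finally show ?case
        using upper by blast
    qed
  qed
  have small: "\<forall>\<^sub>F s in at_right 0. 0 < s \<and> s < c0 / 2 \<and> s < - \<rho> z"
  proof -
    have "\<rho> z < 0"
      using \<open>z \<in> D\<close> by (simp add: D S_def)
    then show ?thesis
      unfolding eventually_at_right_field using c0
      by (intro exI[of _ "min (c0 / 2) (- \<rho> z)"]) auto
  qed
  show ?thesis
  proof (rule order_tendstoI)
    fix y assume y: "y < green D z w"
    have "((\<lambda>s. exp (- 2 * A * s) * green D z w) \<longlongrightarrow> green D z w) (at_right 0)"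
      by (rule tendsto_eq_intros refl | simp)+
    from eventually_happens'[OF _ eventually_conj[OF small order_tendstoD(1)[OF this y]]]
    obtain s where s: "0 < s" "s < c0 / 2" "s < - \<rho> z" "y < exp (- 2 * A * s) * green D z w"
      by auto
    show "\<forall>\<^sub>F n in sequentially. y < green (Dn n) z w"
      using sandwich[OF s(1-3)] by eventually_elim (use s in simp)
  next
    fix y assume y: "green D z w < y"
    have "((\<lambda>s. exp (2 * A * s) * green D z w) \<longlongrightarrow> green D z w) (at_right 0)"
      by (rule tendsto_eq_intros refl | simp)+
    from eventually_happens'[OF _ eventually_conj[OF small order_tendstoD(2)[OF this y]]]
    obtain s where s: "0 < s" "s < c0 / 2" "s < - \<rho> z" "exp (2 * A * s) * green D z w < y"
      by auto
    show "\<forall>\<^sub>F n in sequentially. green (Dn n) z w < y"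
      using sandwich[OF s(1-3)] by eventually_elim (use s in simp)
  qed
qed

end
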